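(* Let $k \geqslant 2$ be a fixed integer. There exists $n_0 = n_0(k)$ such that for every integer $n \geqslant n_0$ and every positive integer $q$ the following hold for the $(1:q)$ Waiter--Client $k$--SAT game played on the set $\mathcal{C}^{(k)}_n$ of all $k$--clauses over $n$ boolean variables. (i) If $q \leqslant \binom{n}{k}/(2n)$, then Waiter has a strategy ensuring that the conjunction of all $k$--clauses claimed by Client by the end of the game is not satisfiable. (ii) If $q \geqslant 2^{3k/2}e^{k/2+1}k\binom{n}{k}/n$, then Client has a strategy ensuring that the conjunction of all $k$--clauses he claims remains satisfiable throughout the game.
   Context: Fix boolean variables $x_1,\ldots,x_n$. A literal is a variable $x_i$ or its negation $\neg x_i$. A $k$--clause is the disjunction of exactly $k$ non--complementary literals, i.e. of $k$ literals belonging to $k$ distinct variables (clauses are identified with their sets of literals). $\mathcal{C}^{(k)}_n$ denotes the set of all $2^k\binom{n}{k}$ possible $k$--clauses over $x_1,\ldots,x_n$. A conjunction of $k$--clauses is satisfiable if some $\{0,1\}$--assignment to the variables makes every clause true. The $(1:q)$ Waiter--Client game $(X,\mathcal{F})$, where $X$ is a finite set (the board), $\mathcal{F}$ is the family of winning sets (subsets of $X$) and $q$ is a positive integer, is the following two--player perfect information game. At the beginning of each round, Waiter offers Client exactly $q+1$ free (that is, previously unclaimed) elements of $X$ of Waiter's choice. Client claims one of these, and the remaining $q$ offered elements are claimed by Waiter. If in the last round only $1\leqslant r<q+1$ free elements remain, Waiter claims all of them. The game ends when all elements of $X$ are claimed. Waiter wins if Client has fully claimed some winning set in $\mathcal{F}$;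 otherwise Client wins. The $k$--SAT game has board $X=\mathcal{C}^{(k)}_n$, and its winning sets are the sets $\mathcal{S}\subseteq\mathcal{C}^{(k)}_n$ whose conjunction $\bigwedge\mathcal{S}$ is not satisfiable. Here $e$ is the base of the natural logarithm. *)

theory Defs
  imports Complex_Main
begin

section \<open>Clauses\<close>

datatype literal = Pos nat | Neg nat

fun var :: "literal \<Rightarrow> nat" where
  "var (Pos i) = i"
| "var (Neg i) = i"

type_synonym clause = "literal set"

text \<open>Injectivity of \<open>var\<close> says that the \<open>k\<close> literals belong to \<open>k\<close> distinct variables.\<close>

definition kclauses :: "nat \<Rightarrow> nat \<Rightarrow> clause set" where
  "kclauses k n = {c. card c = k \<and> inj_on var c \<and> var ` c \<subseteq> {1..n}}"

fun lit_true :: "(nat \<Rightarrow> bool) \<Rightarrow> literal \<Rightarrow> bool" where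
  "lit_true a (Pos i) = a i"
| "lit_true a (Neg i) = (\<not> a i)"

definition satisfiable :: "clause set \<Rightarrow> bool" where
  "satisfiable S \<longleftrightarrow> (\<exists>a. \<forall>c\<in>S. \<exists>l\<in>c. lit_true a l)"

section \<open>Waiter-Client games\<close>

text \<open>
  A history is the chronological list of the full rounds played so far, each recorded as the
  pair of the offered set and the element of it claimed by Client. The closing step, in which
  Waiter takes fewer than \<open>q + 1\<close> leftover elements, involves no choice and does not change
  Client's set, so it is not recorded: a history is complete once at most \<open>q\<close> elements are free.
\<close>

type_synonym 'a history = "('a set \<times> 'a) list"

definition free :: "'a set \<Rightarrow> 'a history \<Rightarrow> 'a set" where
  "free X h = X - \<Union>(fst ` set h)"

definition client_claimed :: "'a history \<Rightarrow> 'a set" where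
  "client_claimed h = snd ` set h"

definition legal_offer :: "'a set \<Rightarrow> nat \<Rightarrow> 'a history \<Rightarrow> 'a set \<Rightarrow> bool" where
  "legal_offer X q h A \<longleftrightarrow> A \<subseteq> free X h \<and> card A = q + 1"

inductive legal_play :: "'a set \<Rightarrow> nat \<Rightarrow> 'a history \<Rightarrow> bool" for X q where
  start: "legal_play X q []"
| round: "legal_play X q h \<Longrightarrow> legal_offer X q h A \<Longrightarrow> c \<in> A \<Longrightarrow> legal_play X q (h @ [(A, c)])"

definition complete_play :: "'a set \<Rightarrow> nat \<Rightarrow> 'a history \<Rightarrow> bool" where
  "complete_play X q h \<longleftrightarrow> legal_play X q h \<and> card (free X h) < q + 1"

definition waiter_strategy :: "'a set \<Rightarrow> nat \<Rightarrow> ('a history \<Rightarrow> 'a set) \<Rightarrow> bool" where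
  "waiter_strategy X q \<sigma> \<longleftrightarrow>
     (\<forall>h. legal_play X q h \<and> q + 1 \<le> card (free X h) \<longrightarrow> legal_offer X q h (\<sigma> h))"

definition client_strategy :: "'a set \<Rightarrow> nat \<Rightarrow> ('a history \<Rightarrow> 'a set \<Rightarrow> 'a) \<Rightarrow> bool" where
  "client_strategy X q \<tau> \<longleftrightarrow>
     (\<forall>h A. legal_play X q h \<and> legal_offer X q h A \<longrightarrow> \<tau> h A \<in> A)"

definition waiter_follows :: "('a history \<Rightarrow> 'a set) \<Rightarrow> 'a history \<Rightarrow> bool" where
  "waiter_follows \<sigma> h \<longleftrightarrow> (\<forall>i<length h. fst (h ! i) = \<sigma> (take i h))"

definition client_follows :: "('a history \<Rightarrow> 'a set \<Rightarrow> 'a) \<Rightarrow> 'a history \<Rightarrow> bool" where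
  "client_follows \<tau> h \<longleftrightarrow> (\<forall>i<length h. snd (h ! i) = \<tau> (take i h) (fst (h ! i)))"

section \<open>The winning sets of the k-SAT game\<close>

definition ksat_winning_sets :: "nat \<Rightarrow> nat \<Rightarrow> clause set set" where
  "ksat_winning_sets k n = {S. S \<subseteq> kclauses k n \<and> \<not> satisfiable S}"

lemma client_claimed_subset:
  assumes "legal_play X q h"
  shows "client_claimed h \<subseteq> X"
  using assms
  by induction (auto simp: client_claimed_def legal_offer_def free_def)

text \<open>
  Client has fully claimed a winning set iff the conjunction of all of his clauses is
  unsatisfiable, so the outcome of the game can be stated in terms of the latter.
\<close>

lemma ksat_winning_iff:
  assumes "legal_play (kclauses k n) q h"
  shows "(\<exists>S\<in>ksat_winning_sets k n. S \<subseteq> client_claimed h) \<longleftrightarrow> \<not> satisfiable (client_claimed h)"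
proof
  assume "\<exists>S\<in>ksat_winning_sets k n. S \<subseteq> client_claimed h"
  then show "\<not> satisfiable (client_claimed h)"
    unfolding ksat_winning_sets_def satisfiable_def by blast
next
  assume "\<not> satisfiable (client_claimed h)"
  then show "\<exists>S\<in>ksat_winning_sets k n. S \<subseteq> client_claimed h"
    using client_claimed_subset[OF assms] unfolding ksat_winning_sets_def by blast
qed

end

theory Submission
  imports Defs "HOL-Analysis.Convex"
begin

text \<open>
  (i) Client must be forced to hit, for each assignment, the set of the \<open>n choose k\<close> clauses it
  falsifies. An assignment satisfying all of Client's clauses so far, with \<open>d\<close> free clauses
  falsifying it, gets weight \<open>(3/2)\<close> to the power \<open>- d / q\<close>; a clause gets the total weight of the
  surviving assignments it falsifies. If Waiter offers \<open>q + 1\<close> clauses whose weights agree up to a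
  factor 2, the total weight of the survivors does not increase: since
  \<open>r \<mapsto> (3/2)\<^sup>r\<close> is below its chord on \<open>[0, 1]\<close>, the loss from Client's clause outweighs the gain from
  Waiter's \<open>q\<close> clauses. If no such offer existed, the clause weights would decay geometrically in
  blocks of \<open>q\<close> and sum to at most \<open>2 q\<close> times the total weight, so some survivor would have
  \<open>d \<le> 2 q\<close> and hence weight at least \<open>4/9\<close>. The initial total is at most
  \<open>2\<^sup>n (3/2)\<close> to the power \<open>- 2 n\<close>, that is \<open>(8/9)\<^sup>n\<close>.

  (ii) By Hall's theorem an unsatisfiable set of clauses contains \<open>t + 1\<close> clauses on some \<open>t\<close>
  variables. Client avoids all of these sets by derandomising a uniformly random choice: the
  expected number of such sets that he completes is bounded by a geometric series of sum less than 1.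
\<close>

section \<open>Forcing a transversal\<close>

lemma free_append: "free X (h @ [(A, c)]) = free X h - A"
  by (auto simp: free_def)

lemma client_claimed_append: "client_claimed (h @ [(A, c)]) = insert c (client_claimed h)"
  by (auto simp: client_claimed_def)

lemma finite_free: "finite X \<Longrightarrow> finite (free X h)"
  by (simp add: free_def)

lemma waiter_follows_append:
  "waiter_follows \<sigma> (h @ [(A, c)]) \<longleftrightarrow> waiter_follows \<sigma> h \<and> A = \<sigma> h"
  by (auto simp: waiter_follows_def nth_append less_Suc_eq)

lemma client_follows_append:
  "client_follows \<tau> (h @ [(A, c)]) \<longleftrightarrow> client_follows \<tau> h \<and> c = \<tau> h A"
  by (auto simp: client_follows_def nth_append less_Suc_eq)

text \<open>Let \<open>m\<close> be the largest weight. The elements of weight at least m/2 agree up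
  to a factor 2, so there are at most \<open>q\<close> of them, contributing at most q * m. All
  others weigh less than m/2, and induction with m/2 in place of \<open>M\<close> bounds their sum
  by q * m as well.\<close>

lemma sum_le_if_no_balanced_block:
  fixes w :: "'a \<Rightarrow> real"
  assumes "finite S" and "\<And>x. x \<in> S \<Longrightarrow> 0 \<le> w x" and "\<And>x. x \<in> S \<Longrightarrow> w x \<le> M" and "0 \<le> M"
    and no_block: "\<And>A. A \<subseteq> S \<Longrightarrow> card A = q + 1 \<Longrightarrow> \<exists>x\<in>A. \<exists>y\<in>A. w x > 2 * w y"
  shows "sum w S \<le> 2 * real q * M"
  using assms
proof (induction "card S" arbitrary: S M rule: less_induct)
  case less
  show ?case
  proof (cases "S = {}")
    case True
    with less.prems show ?thesis by simp
  next
    case False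
    define m where "m = Max (w ` S)"
    have "m \<in> w ` S"
      unfolding m_def using False less.prems(1) by (intro Max_in) auto
    then obtain z where z: "z \<in> S" "w z = m" by auto
    have le_m: "w x \<le> m" if "x \<in> S" for x
      unfolding m_def using that less.prems(1) by simp
    have m: "0 \<le> m" "m \<le> M" using z less.prems by auto
    define U where "U = {x \<in> S. m / 2 \<le> w x}"
    have U: "U \<subseteq> S" "z \<in> U" "finite U" using z m less.prems(1) by (auto simp: U_def)
    have "card U \<le> q"
    proof (rule ccontr)
      assume "\<not> card U \<le> q"
      then obtain A where A: "A \<subseteq> U" "card A = q + 1"
        using obtain_subset_with_card_n[of "q + 1" U] by (auto simp: not_le Suc_le_eq)
      then obtain x y where "x \<in> A" "y \<in> A" "w x > 2 * w y"
        using less.prems(5)[of A] U by blast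
      moreover from this have "w x \<le> m" "m / 2 \<le> w y" using A le_m by (auto simp: U_def)
      ultimately show False by simp
    qed
    have "sum w U \<le> real (card U) * m"
      using sum_bounded_above[of U w m] le_m U by auto
    also have "\<dots> \<le> real q * m"
      using \<open>card U \<le> q\<close> m by (intro mult_right_mono) auto
    finally have sumU: "sum w U \<le> real q * m" .
    have "sum w (S - U) \<le> 2 * real q * (m / 2)"
    proof (rule less.hyps)
      show "card (S - U) < card S"
        using U z less.prems(1) by (intro psubset_card_mono) auto
      show "\<exists>x\<in>A. \<exists>y\<in>A. w x > 2 * w y" if "A \<subseteq> S - U" "card A = q + 1" for A
        using less.prems(5)[of A] that by blast
    qed (use less.prems m in \<open>auto simp: U_def\<close>)
    moreover have "sum w S = sum w U + sum w (S - U)"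
      using sum.subset_diff[OF U(1) less.prems(1)] by (simp add: add.commute)
    moreover have "real q * m \<le> real q * M"
      using m by (intro mult_left_mono) auto
    ultimately show ?thesis using sumU by simp
  qed
qed

section \<open>Waiter's potential function\<close>

lemma powr_three_halves_le:
  fixes r :: real
  assumes "0 \<le> r" "r \<le> 1"
  shows "(3/2) powr r \<le> 1 + r / 2"
  using Youngs_inequality_0[of r "1 - r" "3/2" 1] assms by (simp add: field_simps)

text \<open>The indices in \<open>I\<close> will be truth assignments and \<open>F i\<close> the
  clauses that \<open>i\<close> falsifies; the game argument works for any finite family of subsets
  of the board.\<close>

definition survivors :: "'i set \<Rightarrow> ('i \<Rightarrow> 'a set) \<Rightarrow> 'a history \<Rightarrow> 'i set" where
  "survivors I F h = {i \<in> I. F i \<inter> client_claimed h = {}}"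

definition survivor_weight :: "'a set \<Rightarrow> nat \<Rightarrow> ('i \<Rightarrow> 'a set) \<Rightarrow> 'a history \<Rightarrow> 'i \<Rightarrow> real" where
  "survivor_weight X q F h i = (3/2) powr (- (real (card (F i \<inter> free X h)) / real q))"

definition element_weight ::
    "'a set \<Rightarrow> nat \<Rightarrow> 'i set \<Rightarrow> ('i \<Rightarrow> 'a set) \<Rightarrow> 'a history \<Rightarrow> 'a \<Rightarrow> real" where
  "element_weight X q I F h x = (\<Sum>i | i \<in> survivors I F h \<and> x \<in> F i. survivor_weight X q F h i)"

definition waiter_potential ::
    "'a set \<Rightarrow> nat \<Rightarrow> 'i set \<Rightarrow> ('i \<Rightarrow> 'a set) \<Rightarrow> 'a history \<Rightarrow> real" where
  "waiter_potential X q I F h = (\<Sum>i\<in>survivors I F h. survivor_weight X q F h i)"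

definition balanced :: "('a \<Rightarrow> real) \<Rightarrow> 'a set \<Rightarrow> bool" where
  "balanced w A \<longleftrightarrow> (\<forall>x\<in>A. \<forall>y\<in>A. w x \<le> 2 * w y)"

lemma survivor_weight_pos: "0 < survivor_weight X q F h i"
  by (simp add: survivor_weight_def)

text \<open>Double counting of the pairs of a survivor \<open>i\<close> and an element of
  \<open>F i\<close> in \<open>B\<close>.\<close>

lemma sum_element_weight:
  assumes "finite I" "finite B"
  shows "(\<Sum>x\<in>B. element_weight X q I F h x) =
    (\<Sum>i\<in>survivors I F h. real (card (F i \<inter> B)) * survivor_weight X q F h i)"
proof -
  have fin: "finite (survivors I F h)" using assms by (simp add: survivors_def)
  have "(\<Sum>x\<in>B. element_weight X q I F h x) =
      (\<Sum>x\<in>B. \<Sum>i\<in>survivors I F h. if x \<in> F i then survivor_weight X q F h i else 0)"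
    unfolding element_weight_def using fin by (simp add: sum.inter_filter)
  also have "\<dots> = (\<Sum>i\<in>survivors I F h. \<Sum>x\<in>B. if x \<in> F i then survivor_weight X q F h i else 0)"
    by (rule sum.swap)
  also have "\<dots> = (\<Sum>i\<in>survivors I F h. real (card (F i \<inter> B)) * survivor_weight X q F h i)"
  proof (rule sum.cong)
    fix i
    have "{x \<in> B. x \<in> F i} = F i \<inter> B" by auto
    then show "(\<Sum>x\<in>B. if x \<in> F i then survivor_weight X q F h i else 0) =
        real (card (F i \<inter> B)) * survivor_weight X q F h i"
      using assms(2) by (simp flip: sum.inter_filter)
  qed simp
  finally show ?thesis .
qed

text \<open>Client's choice of \<open>c\<close> removes exactly the weight of \<open>c\<close>. A
  remaining survivor with \<open>j\<close> elements in the offer grows by a factor of at most 1 +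
  j/(2q). By double counting, the total gain is at most 1/(2q) times the weight of Waiter's
  \<open>q\<close> elements, each at most twice as heavy as \<open>c\<close>; so the gain does not
  exceed the loss.\<close>

lemma waiter_potential_append_le:
  assumes "finite X" "finite I" "q \<ge> 1" and offer: "legal_offer X q h A" and "c \<in> A"
    and bal: "balanced (element_weight X q I F h) A"
  shows "waiter_potential X q I F (h @ [(A, c)]) \<le> waiter_potential X q I F h"
proof -
  let ?S = "survivors I F h" and ?\<phi> = "survivor_weight X q F h" and ?w = "element_weight X q I F h"
  define S' where "S' = {i \<in> ?S. c \<notin> F i}"
  have A: "A \<subseteq> free X h" "card A = q + 1" using offer by (auto simp: legal_offer_def)
  have finA: "finite A" using A(2) by (auto intro: card_ge_0_finite)
  have finS: "finite ?S" using assms by (simp add: survivors_def)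
  have S': "survivors I F (h @ [(A, c)]) = S'"
    by (auto simp: survivors_def S'_def client_claimed_append)
  have cardA': "card (A - {c}) = q" using A \<open>c \<in> A\<close> by simp
  have step: "survivor_weight X q F (h @ [(A, c)]) i
      \<le> ?\<phi> i + real (card (F i \<inter> (A - {c}))) * ?\<phi> i / (2 * real q)" if "i \<in> S'" for i
  proof -
    define j where "j = card (F i \<inter> (A - {c}))"
    \<comment> \<open>As \<open>c\<close> is outside \<open>F i\<close>, all lost elements are among
      Waiter's \<open>q\<close> ones, so j/q lies in [0, 1], where the chord bound applies.\<close>
    have eq: "F i \<inter> (A - {c}) = F i \<inter> A" using that by (auto simp: S'_def)
    have "j \<le> q"
      unfolding j_def using card_mono[of "A - {c}" "F i \<inter> (A - {c})"] finA cardA' by auto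
    have sub: "F i \<inter> A \<subseteq> F i \<inter> free X h" using A by auto
    have "F i \<inter> free X (h @ [(A, c)]) = (F i \<inter> free X h) - (F i \<inter> A)"
      by (auto simp: free_append)
    moreover have "card ((F i \<inter> free X h) - (F i \<inter> A)) = card (F i \<inter> free X h) - j"
      using sub finA eq by (simp add: card_Diff_subset j_def)
    moreover have "j \<le> card (F i \<inter> free X h)"
      unfolding j_def eq using sub finite_free[OF assms(1)] by (intro card_mono) auto
    ultimately have "survivor_weight X q F (h @ [(A, c)]) i =
        (3/2) powr (- (real (card (F i \<inter> free X h)) / real q) + real j / real q)"
      by (simp add: survivor_weight_def of_nat_diff diff_divide_distrib)
    also have "\<dots> = ?\<phi> i * (3/2) powr (real j / real q)"
      unfolding survivor_weight_def by (rule powr_add)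
    also have "\<dots> \<le> ?\<phi> i * (1 + (real j / real q) / 2)"
      using \<open>j \<le> q\<close> \<open>q \<ge> 1\<close> survivor_weight_pos[of X q F h i]
      by (intro mult_left_mono powr_three_halves_le) auto
    finally show ?thesis by (simp add: j_def algebra_simps)
  qed
  have "waiter_potential X q I F (h @ [(A, c)])
      \<le> (\<Sum>i\<in>S'. ?\<phi> i + real (card (F i \<inter> (A - {c}))) * ?\<phi> i / (2 * real q))"
    unfolding waiter_potential_def S' by (intro sum_mono step)
  also have "\<dots> = (\<Sum>i\<in>S'. ?\<phi> i) + (\<Sum>i\<in>S'. real (card (F i \<inter> (A - {c}))) * ?\<phi> i) / (2 * real q)"
    by (simp add: sum.distrib sum_divide_distrib)
  also have "(\<Sum>i\<in>S'. ?\<phi> i) = waiter_potential X q I F h - ?w c"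
  proof -
    have "?S = S' \<union> {i. i \<in> ?S \<and> c \<in> F i}" by (auto simp: S'_def)
    then have "waiter_potential X q I F h = (\<Sum>i\<in>S'. ?\<phi> i) + ?w c"
      unfolding waiter_potential_def element_weight_def
      using finS by (subst (1) \<open>?S = _\<close>, subst sum.union_disjoint) (auto simp: S'_def)
    then show ?thesis by simp
  qed
  also have "(\<Sum>i\<in>S'. real (card (F i \<inter> (A - {c}))) * ?\<phi> i)
      \<le> (\<Sum>i\<in>?S. real (card (F i \<inter> (A - {c}))) * ?\<phi> i)"
    using finS survivor_weight_pos[of X q F h]
    by (intro sum_mono2) (auto simp: S'_def less_imp_le)
  also have "\<dots> = (\<Sum>x\<in>A - {c}. ?w x)"
    using assms finA by (simp add: sum_element_weight)
  also have "\<dots> \<le> real (card (A - {c})) * (2 * ?w c)"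
    using bal \<open>c \<in> A\<close> by (intro sum_bounded_above) (auto simp: balanced_def)
  finally show ?thesis
    using \<open>q \<ge> 1\<close> cardA' by (simp add: divide_right_mono field_simps)
qed

text \<open>Two bounds on the total weight of the free elements collide. Without a balanced offer it
  is at most 2 * q times the potential. But a potential below 4/9 leaves every survivor more than 2
  * q free elements, and double counting then gives strictly more.\<close>

lemma ex_balanced_offer:
  assumes "finite X" "finite I" "q \<ge> 1" "q + 1 \<le> card (free X h)"
    and small: "waiter_potential X q I F h < 4 / 9"
  shows "\<exists>A. legal_offer X q h A \<and> balanced (element_weight X q I F h) A"
proof (rule ccontr)
  let ?S = "survivors I F h" and ?\<phi> = "survivor_weight X q F h" and ?w = "element_weight X q I F h"
  let ?\<Phi> = "waiter_potential X q I F h"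
  assume none: "\<not> ?thesis"
  have finS: "finite ?S" using assms by (simp add: survivors_def)
  have fin: "finite (free X h)" using assms(1) by (rule finite_free)
  have w_le: "?w x \<le> ?\<Phi>" for x
    unfolding element_weight_def waiter_potential_def using finS survivor_weight_pos[of X q F h]
    by (intro sum_mono2) (auto simp: less_imp_le)
  have w_nonneg: "0 \<le> ?w x" for x
    unfolding element_weight_def using survivor_weight_pos[of X q F h]
    by (intro sum_nonneg) (auto simp: less_imp_le)
  have upper: "sum ?w (free X h) \<le> 2 * real q * ?\<Phi>"
  proof (rule sum_le_if_no_balanced_block)
    show "\<exists>x\<in>A. \<exists>y\<in>A. ?w x > 2 * ?w y" if "A \<subseteq> free X h" "card A = q + 1" for A
      using none that unfolding legal_offer_def balanced_def by force
    show "0 \<le> ?\<Phi>" using w_le w_nonneg order_trans by blast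
  qed (use fin w_le w_nonneg in auto)
  \<comment> \<open>A survivor is needed for the strict inequality below. Without survivors all
    weights vanish and every offer is balanced.\<close>
  have "?S \<noteq> {}"
  proof
    assume "?S = {}"
    then have "balanced ?w A" for A by (simp add: balanced_def element_weight_def)
    moreover obtain A where "A \<subseteq> free X h" "card A = q + 1"
      using assms(4) by (meson obtain_subset_with_card_n)
    ultimately show False using none by (auto simp: legal_offer_def)
  qed
  have large: "2 * real q < real (card (F i \<inter> free X h))" if "i \<in> ?S" for i
  proof (rule ccontr)
    assume "\<not> ?thesis"
    then have "- 2 \<le> - (real (card (F i \<inter> free X h)) / real q)"
      using \<open>q \<ge> 1\<close> by (simp add: field_simps)
    then have "(3/2 :: real) powr (- 2) \<le> ?\<phi> i"
      unfolding survivor_weight_def by (intro powr_mono) auto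
    also have "?\<phi> i \<le> ?\<Phi>"
      unfolding waiter_potential_def using that finS survivor_weight_pos[of X q F h]
      by (intro member_le_sum) (auto simp: less_imp_le)
    finally show False using small by (simp add: powr_minus power2_eq_square)
  qed
  have "2 * real q * ?\<Phi> = (\<Sum>i\<in>?S. 2 * real q * ?\<phi> i)"
    by (simp add: waiter_potential_def sum_distrib_left)
  also have "\<dots> < (\<Sum>i\<in>?S. real (card (F i \<inter> free X h)) * ?\<phi> i)"
    using finS \<open>?S \<noteq> {}\<close> large survivor_weight_pos[of X q F h]
    by (intro sum_strict_mono mult_strict_right_mono) auto
  also have "\<dots> = sum ?w (free X h)"
    using assms fin by (simp add: sum_element_weight)
  finally show False using upper by simp
qed

text \<open>Balanced offers keep the potential below 4/9. At the end at most \<open>q\<close>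
  elements are free, so a set \<open>F i\<close> that Client missed would alone contribute at least
  2/3.\<close>

theorem waiter_transversal:
  assumes "finite X" "finite I" "q \<ge> 1" and sub: "\<And>i. i \<in> I \<Longrightarrow> F i \<subseteq> X"
    and small: "(\<Sum>i\<in>I. (3/2) powr (- (real (card (F i)) / real q))) < 4 / 9"
  shows "\<exists>\<sigma>. waiter_strategy X q \<sigma> \<and>
    (\<forall>h. complete_play X q h \<and> waiter_follows \<sigma> h \<longrightarrow> (\<forall>i\<in>I. F i \<inter> client_claimed h \<noteq> {}))"
proof -
  let ?good = "\<lambda>h A. legal_offer X q h A \<and> balanced (element_weight X q I F h) A"
  \<comment> \<open>The last branch makes the strategy legal after every legal play; along plays
    that follow it, the invariant guarantees a balanced offer.\<close>
  define \<sigma> where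
    "\<sigma> h = (if \<exists>A. ?good h A then SOME A. ?good h A else SOME A. legal_offer X q h A)" for h
  have legal: "legal_offer X q h (\<sigma> h)" if "q + 1 \<le> card (free X h)" for h
  proof (cases "\<exists>A. ?good h A")
    case True
    then show ?thesis unfolding \<sigma>_def using someI_ex[OF True] by simp
  next
    case False
    have "\<exists>A. legal_offer X q h A"
      using that unfolding legal_offer_def by (meson obtain_subset_with_card_n)
    then show ?thesis unfolding \<sigma>_def if_not_P[OF False] by (rule someI_ex)
  qed
  have start: "waiter_potential X q I F [] < 4 / 9"
  proof -
    have "survivor_weight X q F [] i = (3/2) powr (- (real (card (F i)) / real q))" if "i \<in> I" for i
      using sub[OF that] by (simp add: survivor_weight_def free_def Int_absorb2)
    moreover have "survivors I F [] = I" by (simp add: survivors_def client_claimed_def)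
    ultimately show ?thesis using small by (simp add: waiter_potential_def)
  qed
  have invariant: "waiter_potential X q I F h < 4 / 9"
    if "legal_play X q h" "waiter_follows \<sigma> h" for h
    using that
  proof induction
    case start
    show ?case by (rule \<open>waiter_potential X q I F [] < 4 / 9\<close>)
  next
    case (round h A c)
    then have A: "A = \<sigma> h" and small_h: "waiter_potential X q I F h < 4 / 9"
      by (auto simp: waiter_follows_append)
    have "q + 1 \<le> card (free X h)"
      using round.hyps(2) card_mono[OF finite_free[OF assms(1)]] by (metis legal_offer_def)
    then have ex: "\<exists>A. ?good h A"
      using ex_balanced_offer assms small_h by blast
    have "?good h A"
      unfolding A \<sigma>_def using someI_ex[OF ex] ex by simp
    then show ?case
      using waiter_potential_append_le[of X I q h A c F] assms round.hyps small_h by auto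
  qed
  have "F i \<inter> client_claimed h \<noteq> {}"
    if "complete_play X q h" "waiter_follows \<sigma> h" "i \<in> I" for h i
  proof
    assume "F i \<inter> client_claimed h = {}"
    then have i: "i \<in> survivors I F h" using that by (simp add: survivors_def)
    have "card (F i \<inter> free X h) \<le> q"
      using that(1) card_mono[OF finite_free[OF assms(1)], of "F i \<inter> free X h" h]
      by (auto simp: complete_play_def)
    then have "- 1 \<le> - (real (card (F i \<inter> free X h)) / real q)"
      using \<open>q \<ge> 1\<close> by (simp add: field_simps)
    then have "(3/2 :: real) powr (- 1) \<le> survivor_weight X q F h i"
      unfolding survivor_weight_def by (intro powr_mono) auto
    also have "\<dots> \<le> waiter_potential X q I F h"
      unfolding waiter_potential_def using i assms(2) survivor_weight_pos[of X q F h]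
      by (intro member_le_sum) (auto simp: less_imp_le survivors_def)
    also have "\<dots> < 4 / 9"
      using invariant that by (simp add: complete_play_def)
    finally show False by (simp add: powr_minus)
  qed
  then show ?thesis
    using legal unfolding waiter_strategy_def by blast
qed

section \<open>Avoiding a family of sets\<close>

lemma client_claimed_disjoint_free:
  assumes "legal_play X q h"
  shows "client_claimed h \<inter> free X h = {}"
  using assms by induction (auto simp: client_claimed_def free_def)

text \<open>
  The expected number of members of \<open>\<F>\<close> that Client will fully claim if he plays uniformly at
  random from now on is at most this sum.
\<close>

definition client_potential :: "'a set \<Rightarrow> nat \<Rightarrow> 'a set set \<Rightarrow> 'a history \<Rightarrow> real" where
  "client_potential X q \<F> h =
    (\<Sum>F\<in>\<F>. if F \<subseteq> client_claimed h \<union> free X h then (1 / (real q + 1)) ^ card (F \<inter> free X h) else 0)"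

text \<open>Averaging over the \<open>q + 1\<close> choices. A set disjoint from the offer keeps its
  term or loses it. A set containing an offered \<open>d\<close> survives only if Client takes
  \<open>d\<close>, and its term then grows by the factor \<open>q + 1\<close>; so no set's average
  contribution increases.\<close>

lemma ex_client_move:
  assumes "finite X" and "legal_play X q h" and offer: "legal_offer X q h A"
  shows "\<exists>c\<in>A. client_potential X q \<F> (h @ [(A, c)]) \<le> client_potential X q \<F> h"
proof -
  let ?K = "client_claimed h" and ?R = "free X h" and ?p = "1 / (real q + 1)"
  have A: "A \<subseteq> ?R" "card A = q + 1" using offer by (auto simp: legal_offer_def)
  have finA: "finite A" using A(2) by (auto intro: card_ge_0_finite)
  have finR: "finite ?R" using assms(1) by (rule finite_free)
  have disj: "?K \<inter> ?R = {}" using assms(2) by (rule client_claimed_disjoint_free)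
  let ?old = "\<lambda>F. if F \<subseteq> ?K \<union> ?R then ?p ^ card (F \<inter> ?R) else 0"
  let ?new = "\<lambda>c F. if F \<subseteq> insert c ?K \<union> (?R - A) then ?p ^ card (F \<inter> (?R - A)) else 0"
  have avg: "(\<Sum>c\<in>A. ?new c F) \<le> (real q + 1) * ?old F" for F
  proof (cases "F \<inter> A = {}")
    case True
    then have "F \<inter> (?R - A) = F \<inter> ?R" by auto
    moreover have "F \<subseteq> ?K \<union> ?R" if "c \<in> A" "F \<subseteq> insert c ?K \<union> (?R - A)" for c
      using that A by blast
    ultimately have "?new c F \<le> ?old F" if "c \<in> A" for c
      using that by simp
    then have "(\<Sum>c\<in>A. ?new c F) \<le> real (card A) * ?old F"
      by (intro sum_bounded_above)
    then show ?thesis using A(2) by (simp add: add.commute)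
  next
    case False
    then obtain d where d: "d \<in> F" "d \<in> A" by auto
    have zero: "?new c F = 0" if "c \<in> A - {d}" for c
    proof -
      have "d \<notin> insert c ?K \<union> (?R - A)" using that d A disj by blast
      then have "\<not> F \<subseteq> insert c ?K \<union> (?R - A)" using d by blast
      then show ?thesis by (rule if_not_P)
    qed
    have "(\<Sum>c\<in>A. ?new c F) = ?new d F + (\<Sum>c\<in>A - {d}. ?new c F)"
      by (rule sum.remove[OF finA d(2)])
    also have "(\<Sum>c\<in>A - {d}. ?new c F) = 0"
      by (rule sum.neutral) (use zero in blast)
    finally have "(\<Sum>c\<in>A. ?new c F) = ?new d F" by (simp only: add_0_right)
    also have "\<dots> \<le> (real q + 1) * ?old F"
    proof (cases "F \<subseteq> insert d ?K \<union> (?R - A)")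
      case True
      have "d \<in> ?R" using d A by blast
      then have "F \<inter> ?R = insert d (F \<inter> (?R - A))" "F \<subseteq> ?K \<union> ?R"
        using True d disj by blast+
      moreover have "d \<notin> F \<inter> (?R - A)" "finite (F \<inter> (?R - A))" using d finR by auto
      ultimately show ?thesis using True by simp
    qed simp
    finally show ?thesis .
  qed
  have "(\<Sum>c\<in>A. client_potential X q \<F> (h @ [(A, c)])) = (\<Sum>F\<in>\<F>. \<Sum>c\<in>A. ?new c F)"
    unfolding client_potential_def client_claimed_append free_append by (rule sum.swap)
  also have "\<dots> \<le> (\<Sum>F\<in>\<F>. (real q + 1) * ?old F)"
    by (intro sum_mono avg)
  also have "\<dots> = (\<Sum>c\<in>A. client_potential X q \<F> h)"
    using A(2) by (simp add: client_potential_def sum_distrib_left add.commute)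
  finally show ?thesis
    using sum_strict_mono[of A "\<lambda>_. client_potential X q \<F> h"
        "\<lambda>c. client_potential X q \<F> (h @ [(A, c)])"] finA A(2)
    by (force simp: not_le)
qed

text \<open>A fully claimed member of the family contributes 1 to the potential, which starts below
  1 and never increases under moves chosen by averaging.\<close>

theorem client_avoids:
  assumes "finite X" "finite \<F>" and sub: "\<And>F. F \<in> \<F> \<Longrightarrow> F \<subseteq> X"
    and small: "(\<Sum>F\<in>\<F>. (1 / (real q + 1)) ^ card F) < 1"
  shows "\<exists>\<tau>. client_strategy X q \<tau> \<and>
    (\<forall>h. legal_play X q h \<and> client_follows \<tau> h \<longrightarrow> (\<forall>F\<in>\<F>. \<not> F \<subseteq> client_claimed h))"
proof -
  let ?\<Phi> = "client_potential X q \<F>"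
  define \<tau> where "\<tau> h A = (SOME c. c \<in> A \<and> ?\<Phi> (h @ [(A, c)]) \<le> ?\<Phi> h)" for h A
  have \<tau>: "\<tau> h A \<in> A \<and> ?\<Phi> (h @ [(A, \<tau> h A)]) \<le> ?\<Phi> h"
    if "legal_play X q h" "legal_offer X q h A" for h A
  proof -
    have "\<exists>c. c \<in> A \<and> ?\<Phi> (h @ [(A, c)]) \<le> ?\<Phi> h"
      using ex_client_move[OF assms(1) that] by blast
    then show ?thesis unfolding \<tau>_def by (rule someI_ex)
  qed
  have start: "?\<Phi> [] < 1"
  proof -
    have "?\<Phi> [] = (\<Sum>F\<in>\<F>. (1 / (real q + 1)) ^ card F)"
      unfolding client_potential_def
      using sub by (intro sum.cong) (auto simp: free_def client_claimed_def Int_absorb2)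
    then show ?thesis using small by simp
  qed
  have invariant: "?\<Phi> h < 1" if "legal_play X q h" "client_follows \<tau> h" for h
    using that
  proof induction
    case start
    show ?case by (rule \<open>?\<Phi> [] < 1\<close>)
  next
    case (round h A c)
    then show ?case using \<tau>[of h A] by (auto simp: client_follows_append)
  qed
  have "\<not> F \<subseteq> client_claimed h"
    if "legal_play X q h" "client_follows \<tau> h" "F \<in> \<F>" for h F
  proof
    assume F: "F \<subseteq> client_claimed h"
    then have "F \<inter> free X h = {}" using client_claimed_disjoint_free[OF that(1)] by auto
    then have "1 = (if F \<subseteq> client_claimed h \<union> free X h
        then (1 / (real q + 1)) ^ card (F \<inter> free X h) else 0)" using F by auto
    also have "\<dots> \<le> ?\<Phi> h"
      unfolding client_potential_def using that(3) assms(2)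
      by (intro member_le_sum[where f = "\<lambda>F. if F \<subseteq> client_claimed h \<union> free X h
        then (1 / (real q + 1)) ^ card (F \<inter> free X h) else 0"]) auto
    finally show False using invariant that by fastforce
  qed
  then show ?thesis using \<tau> unfolding client_strategy_def by blast
qed

section \<open>Hall's theorem\<close>

text \<open>Rado's proof: as long as some \<open>A i\<close> has two elements, one of them can be removed.\<close>

theorem hall_marriage:
  assumes "finite I" and "\<And>i. i \<in> I \<Longrightarrow> finite (A i)"
    and hall: "\<And>J. J \<subseteq> I \<Longrightarrow> card J \<le> card (\<Union>i\<in>J. A i)"
  shows "\<exists>f. inj_on f I \<and> (\<forall>i\<in>I. f i \<in> A i)"
  using assms(2,3)
proof (induction "\<Sum>i\<in>I. card (A i)" arbitrary: A rule: less_induct)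
  case less
  note fin = less.prems(1) and hall = less.prems(2)
  have finU: "finite (\<Union>i\<in>J. A i)" if "J \<subseteq> I" for J
    using that fin \<open>finite I\<close> finite_subset by blast
  show ?case
  proof (cases "\<exists>i\<in>I. \<exists>x\<in>A i. \<exists>y\<in>A i. x \<noteq> y")
    case False
    define f where "f i = (SOME x. x \<in> A i)" for i
    have f: "f i \<in> A i" if "i \<in> I" for i
    proof -
      \<comment> \<open>Here every \<open>A i\<close> has at most one element: Hall's condition for
        one index makes it a singleton, and for two indices makes the singletons distinct.\<close>
      have "card {i} \<le> card (A i)" using hall[of "{i}"] that by simp
      then have "A i \<noteq> {}" by auto
      then show ?thesis unfolding f_def by (simp add: some_in_eq)
    qed
    have "inj_on f I"
    proof (rule inj_onI, rule ccontr)
      fix i j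
      assume ij: "i \<in> I" "j \<in> I" "f i = f j" "i \<noteq> j"
      have "A i \<subseteq> {f i}" "A j \<subseteq> {f i}"
        using False ij f[OF ij(1)] f[OF ij(2)] by force+
      then have "card (A i \<union> A j) \<le> card {f i}" by (intro card_mono) auto
      then show False using hall[of "{i, j}"] ij by simp
    qed
    then show ?thesis using f by blast
  next
    case True
    then obtain i x y where i: "i \<in> I" and xy: "x \<in> A i" "y \<in> A i" "x \<noteq> y" by blast
    \<comment> \<open>If Hall's condition survived the removal of \<open>z\<close>, induction would
      yield representatives. A violating index set must contain \<open>i\<close>; deleting
      \<open>i\<close> from it turns the strict inequality into the weak one stated.\<close>
    have violation: "\<exists>J\<subseteq>I - {i}. card ((\<Union>j\<in>J. A j) \<union> (A i - {z})) \<le> card J"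
      if z: "z \<in> A i" and none: "\<not> (\<exists>f. inj_on f I \<and> (\<forall>j\<in>I. f j \<in> A j))" for z
    proof -
      define B where "B = A(i := A i - {z})"
      have "(\<Sum>j\<in>I. card (B j)) < (\<Sum>j\<in>I. card (A j))"
      proof (rule sum_strict_mono_ex1)
        show "\<forall>j\<in>I. card (B j) \<le> card (A j)"
          using fin by (auto simp: B_def intro: card_mono)
        show "\<exists>j\<in>I. card (B j) < card (A j)"
          using i fin z card_Diff1_less[of "A i" z] by (auto simp: B_def)
      qed (rule \<open>finite I\<close>)
      moreover have "\<not> (\<exists>f. inj_on f I \<and> (\<forall>j\<in>I. f j \<in> B j))"
      proof
        assume "\<exists>f. inj_on f I \<and> (\<forall>j\<in>I. f j \<in> B j)"
        then obtain f where f: "inj_on f I" "\<And>j. j \<in> I \<Longrightarrow> f j \<in> B j" by blast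
        have "f j \<in> A j" if "j \<in> I" for j
          using f(2)[OF that] by (auto simp: B_def split: if_splits)
        then show False using none f(1) by blast
      qed
      moreover have "finite (B j)" if "j \<in> I" for j
        using fin that by (auto simp: B_def)
      ultimately obtain J where J: "J \<subseteq> I" "\<not> card J \<le> card (\<Union>j\<in>J. B j)"
        using less.hyps[of B] by blast
      have "i \<in> J"
      proof (rule ccontr)
        assume "i \<notin> J"
        then have "(\<Union>j\<in>J. B j) = (\<Union>j\<in>J. A j)" by (auto simp: B_def)
        then show False using J(2) hall[OF J(1)] by simp
      qed
      have "(\<Union>j\<in>J. B j) = (\<Union>j\<in>J - {i}. A j) \<union> (A i - {z})"
        using \<open>i \<in> J\<close> by (auto simp: B_def split: if_splits)
      moreover have "card J = Suc (card (J - {i}))"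
        using card.remove[OF finite_subset[OF J(1) \<open>finite I\<close>] \<open>i \<in> J\<close>] .
      ultimately have "card ((\<Union>j\<in>J - {i}. A j) \<union> (A i - {z})) \<le> card (J - {i})"
        using J(2) by simp
      then show ?thesis using J(1) by (intro exI[of _ "J - {i}"]) blast
    qed
    show ?thesis
    proof (rule ccontr)
      assume none: "\<not> ?thesis"
      obtain J where J: "J \<subseteq> I - {i}" "card ((\<Union>j\<in>J. A j) \<union> (A i - {x})) \<le> card J"
        using violation[OF xy(1) none] by blast
      obtain L where L: "L \<subseteq> I - {i}" "card ((\<Union>j\<in>L. A j) \<union> (A i - {y})) \<le> card L"
        using violation[OF xy(2) none] by blast
      \<comment> \<open>As \<open>x\<close> and \<open>y\<close> differ, the union of
        \<open>P\<close> and \<open>Q\<close> regains all of \<open>A i\<close>. Hall's condition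
        for \<open>insert i (J \<union> L)\<close> and for \<open>J \<inter> L\<close> then gives
        |P| + |Q| > |J| + |L|, against the choice of \<open>J\<close> and \<open>L\<close>.\<close>
      define P Q where "P = (\<Union>j\<in>J. A j) \<union> (A i - {x})" and "Q = (\<Union>j\<in>L. A j) \<union> (A i - {y})"
      have finPQ: "finite P" "finite Q"
        unfolding P_def Q_def using J(1) L(1) i fin finU[of J] finU[of L] by blast+
      have finJL: "finite J" "finite L" using J L \<open>finite I\<close> by (auto intro: finite_subset)
      have "P \<union> Q = (\<Union>j\<in>insert i (J \<union> L). A j)"
        unfolding P_def Q_def using xy by auto
      moreover have "insert i (J \<union> L) \<subseteq> I" using i J(1) L(1) by blast
      ultimately have "card (insert i (J \<union> L)) \<le> card (P \<union> Q)"
        using hall[of "insert i (J \<union> L)"] by simp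
      moreover have "i \<notin> J \<union> L" using J(1) L(1) by blast
      ultimately have union: "Suc (card (J \<union> L)) \<le> card (P \<union> Q)"
        using finJL by simp
      have "card (J \<inter> L) \<le> card (\<Union>j\<in>J \<inter> L. A j)"
        using J(1) by (intro hall) blast
      also have "\<dots> \<le> card (P \<inter> Q)"
        using finPQ by (intro card_mono) (auto simp: P_def Q_def)
      finally have "Suc (card J + card L) \<le> card P + card Q"
        using union card_Un_Int[OF finPQ] card_Un_Int[OF finJL] by simp
      then show False using J L by (simp add: P_def Q_def)
    qed
  qed
qed

section \<open>The k-SAT game\<close>

definition clauses_over :: "nat \<Rightarrow> nat set \<Rightarrow> clause set" where
  "clauses_over k T = {c. card c = k \<and> inj_on var c \<and> var ` c \<subseteq> T}"

lemma kclauses_eq: "kclauses k n = clauses_over k {1..n}"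
  by (simp add: kclauses_def clauses_over_def)

text \<open>A clause is determined by its set of variables and the subset of those occurring
  positively; this encoding is what counts clauses.\<close>

lemma clause_eq:
  assumes "inj_on var c"
  shows "c = Pos ` {i. Pos i \<in> c} \<union> Neg ` (var ` c - {i. Pos i \<in> c})" (is "c = ?d")
proof (rule set_eqI)
  fix l
  show "l \<in> c \<longleftrightarrow> l \<in> ?d"
  proof (cases l)
    case (Pos i)
    then show ?thesis by auto
  next
    case (Neg i)
    have "Neg i \<in> c \<longleftrightarrow> i \<in> var ` c \<and> Pos i \<notin> c"
    proof
      assume N: "Neg i \<in> c"
      then have "i \<in> var ` c" by force
      moreover have "Pos i \<notin> c"
        using inj_onD[OF assms, of "Pos i" "Neg i"] N by auto
      ultimately show "i \<in> var ` c \<and> Pos i \<notin> c" ..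
    next
      assume *: "i \<in> var ` c \<and> Pos i \<notin> c"
      then obtain l where "l \<in> c" "var l = i" by auto
      then show "Neg i \<in> c" using * by (cases l) auto
    qed
    then show ?thesis using Neg by auto
  qed
qed

lemma
  assumes "finite T"
  shows finite_clauses_over: "finite (clauses_over k T)"
    and card_clauses_over_le: "card (clauses_over k T) \<le> 2 ^ k * (card T choose k)"
proof -
  let ?code = "\<lambda>c. (var ` c, {i. Pos i \<in> c})"
  let ?B = "Sigma {V. V \<subseteq> T \<and> card V = k} Pow"
  have finB: "finite ?B"
    using assms by (intro finite_SigmaI) (auto intro: finite_subset)
  have inj: "inj_on ?code (clauses_over k T)"
  proof (rule inj_onI)
    fix c d
    assume "c \<in> clauses_over k T" "d \<in> clauses_over k T" "?code c = ?code d"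
    then show "c = d"
      using clause_eq[of c] clause_eq[of d] by (auto simp: clauses_over_def)
  qed
  have sub: "?code ` clauses_over k T \<subseteq> ?B"
    by (force simp: clauses_over_def card_image)
  show "finite (clauses_over k T)"
    using inj sub finB by (rule inj_on_finite)
  have "card (clauses_over k T) \<le> card ?B"
    using inj sub finB by (rule card_inj_on_le)
  also have "card ?B = (\<Sum>V | V \<subseteq> T \<and> card V = k. card (Pow V))"
    using assms by (intro card_SigmaI) (auto intro: finite_subset)
  also have "\<dots> = (\<Sum>V | V \<subseteq> T \<and> card V = k. 2 ^ k)"
    using finite_subset[OF _ assms] by (intro sum.cong) (simp_all add: card_Pow)
  also have "\<dots> = 2 ^ k * (card T choose k)"
    using assms by (simp add: n_subsets mult.commute)
  finally show "card (clauses_over k T) \<le> 2 ^ k * (card T choose k)" .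
qed

section \<open>Falsified clauses and Waiter's side\<close>

definition falsified :: "nat \<Rightarrow> nat \<Rightarrow> nat set \<Rightarrow> clause set" where
  "falsified k n P = {c \<in> kclauses k n. \<forall>l\<in>c. \<not> lit_true (\<lambda>i. i \<in> P) l}"

text \<open>Each \<open>k\<close>-set of variables carries a falsified clause: at every variable,
  \<open>l\<close> picks the literal that the assignment makes false.\<close>

lemma card_falsified_ge: "n choose k \<le> card (falsified k n P)"
proof -
  define l where "l i = (if i \<in> P then Neg i else Pos i)" for i
  let ?V = "{V. V \<subseteq> {1..n} \<and> card V = k}"
  have var_l: "var (l i) = i" and lit_l: "\<not> lit_true (\<lambda>i. i \<in> P) (l i)" for i
    by (simp_all add: l_def)
  have inj_l: "inj l" using var_l by (rule inj_on_inverseI)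
  have "inj_on ((`) l) ?V"
    by (rule inj_onI) (use inj_l in \<open>simp add: inj_image_eq_iff\<close>)
  moreover have "(`) l ` ?V \<subseteq> falsified k n P"
  proof (rule image_subsetI)
    fix V assume V: "V \<in> ?V"
    have "card (l ` V) = card V"
      using inj_l by (intro card_image) (rule inj_on_subset[OF _ subset_UNIV])
    moreover have "inj_on var (l ` V)" by (rule inj_onI) (auto simp: var_l)
    moreover have "var ` l ` V = V" by (simp add: image_image var_l)
    ultimately show "l ` V \<in> falsified k n P"
      using V lit_l by (auto simp: falsified_def kclauses_def)
  qed
  moreover have "finite (falsified k n P)"
    using finite_clauses_over[of "{1..n}" k] by (auto simp: falsified_def kclauses_eq)
  ultimately have "card ?V \<le> card (falsified k n P)"
    by (rule card_inj_on_le)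
  then show ?thesis by (simp add: n_subsets)
qed

text \<open>Only the values on the variables 1 to \<open>n\<close> matter, so an assignment may be
  replaced by the set of its true variables there. This makes the family to be hit finite, with 2^n
  indices.\<close>

lemma unsatisfiable_if_hits_falsified:
  assumes "S \<subseteq> kclauses k n"
    and hit: "\<And>P. P \<subseteq> {1..n} \<Longrightarrow> falsified k n P \<inter> S \<noteq> {}"
  shows "\<not> satisfiable S"
proof
  assume "satisfiable S"
  then obtain a where a: "\<And>c. c \<in> S \<Longrightarrow> \<exists>l\<in>c. lit_true a l"
    by (auto simp: satisfiable_def)
  define P where "P = {i \<in> {1..n}. a i}"
  obtain c where c: "c \<in> falsified k n P" "c \<in> S"
    using hit[of P] unfolding P_def by blast
  then obtain l where l: "l \<in> c" "lit_true a l" using a by blast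
  have "var l \<in> {1..n}" using c(1) l(1) by (auto simp: falsified_def kclauses_def)
  then have "lit_true (\<lambda>i. i \<in> P) l" using l(2) by (cases l) (auto simp: P_def)
  then show False using c(1) l(1) by (auto simp: falsified_def)
qed

theorem waiter_ksat:
  assumes "n \<ge> 7" "q \<ge> 1" and q: "real q \<le> real (n choose k) / (2 * real n)"
  shows "\<exists>\<sigma>. waiter_strategy (kclauses k n) q \<sigma> \<and>
    (\<forall>h. complete_play (kclauses k n) q h \<and> waiter_follows \<sigma> h \<longrightarrow>
      \<not> satisfiable (client_claimed h))"
proof -
  let ?X = "kclauses k n" and ?I = "Pow {1..n}"
  have "(\<Sum>P\<in>?I. (3/2) powr (- (real (card (falsified k n P)) / real q)))
      \<le> real (card ?I) * (3/2) powr (- (2 * real n))"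
  proof (intro sum_bounded_above powr_mono)
    fix P
    have "2 * real n * real q \<le> real (n choose k)"
      using q assms(1) by (simp add: field_simps)
    also have "\<dots> \<le> real (card (falsified k n P))"
      using card_falsified_ge by (intro of_nat_mono)
    finally show "- (real (card (falsified k n P)) / real q) \<le> - (2 * real n)"
      using assms(2) by (simp add: field_simps)
  qed auto
  also have "\<dots> = (8/9) ^ n"
  proof -
    have "(3/2 :: real) powr (- (2 * real n)) = (4/9) ^ n"
      by (simp add: powr_minus powr_mult_base powr_realpow[of "3/2" "2 * n", simplified]
        power_mult power2_eq_square power_divide flip: of_nat_mult)
    then show ?thesis by (simp add: card_Pow flip: power_mult_distrib)
  qed
  \<comment> \<open>The exponent 7 is the least for which the power of 8/9 falls below 4/9.\<close>
  also have "\<dots> \<le> (8/9) ^ 7" using assms(1) by (intro power_decreasing) auto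
  also have "\<dots> < (4/9 :: real)" by (simp add: power_divide)
  finally have "\<exists>\<sigma>. waiter_strategy ?X q \<sigma> \<and> (\<forall>h. complete_play ?X q h \<and> waiter_follows \<sigma> h \<longrightarrow>
      (\<forall>P\<in>?I. falsified k n P \<inter> client_claimed h \<noteq> {}))"
    using assms(2) finite_clauses_over[of "{1..n}" k]
    by (intro waiter_transversal) (auto simp: falsified_def kclauses_eq)
  then obtain \<sigma> where strategy: "waiter_strategy ?X q \<sigma>"
    and hits: "\<And>h P. complete_play ?X q h \<Longrightarrow> waiter_follows \<sigma> h \<Longrightarrow> P \<in> ?I \<Longrightarrow>
      falsified k n P \<inter> client_claimed h \<noteq> {}"
    by blast
  have "\<not> satisfiable (client_claimed h)" if "complete_play ?X q h" "waiter_follows \<sigma> h" for h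
  proof (rule unsatisfiable_if_hits_falsified)
    show "client_claimed h \<subseteq> ?X"
      using that(1) client_claimed_subset by (auto simp: complete_play_def)
    show "falsified k n P \<inter> client_claimed h \<noteq> {}" if "P \<subseteq> {1..n}" for P
      using hits \<open>complete_play ?X q h\<close> \<open>waiter_follows \<sigma> h\<close> that by simp
  qed
  then show ?thesis using strategy by blast
qed

section \<open>Client's side: unsatisfiability and dense sets of clauses\<close>

lemma satisfiable_if_hall:
  assumes "finite S" and "\<And>c. c \<in> S \<Longrightarrow> finite c"
    and "\<And>J. J \<subseteq> S \<Longrightarrow> card J \<le> card (\<Union>c\<in>J. var ` c)"
  shows "satisfiable S"
proof -
  \<comment> \<open>Distinct representatives give each clause a variable of its own, which can be
    set to satisfy that clause without conflict.\<close>
  obtain f where f: "inj_on f S" "\<And>c. c \<in> S \<Longrightarrow> f c \<in> var ` c"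
    using hall_marriage[of S "\<lambda>c. var ` c"] assms by blast
  define a where "a v \<longleftrightarrow> (\<exists>c\<in>S. f c = v \<and> Pos v \<in> c)" for v
  have "\<exists>l\<in>c. lit_true a l" if c: "c \<in> S" for c
  proof -
    obtain l where l: "l \<in> c" "var l = f c" using f(2)[OF c] by auto
    show ?thesis
    proof (cases "Pos (f c) \<in> c")
      case True
      then show ?thesis using c by (intro bexI[of _ "Pos (f c)"]) (auto simp: a_def)
    next
      case False
      then have "l = Neg (f c)" using l by (cases l) auto
      moreover have "\<not> a (f c)" using False c inj_onD[OF f(1)] by (auto simp: a_def)
      ultimately show ?thesis using l by (intro bexI[of _ l]) auto
    qed
  qed
  then show ?thesis by (auto simp: satisfiable_def)
qed

text \<open>These are the obstructions to Hall's condition: one more clause than available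
  variables. Fixing the size \<open>t + 1\<close> lets the size of a member determine
  \<open>t\<close>.\<close>

definition dense_sets :: "nat \<Rightarrow> nat \<Rightarrow> nat \<Rightarrow> clause set set" where
  "dense_sets k n t =
    (\<Union>T\<in>{T. T \<subseteq> {1..n} \<and> card T = t}. {S. S \<subseteq> clauses_over k T \<and> card S = t + 1})"

text \<open>If Hall's condition fails for \<open>J\<close>, take \<open>t\<close> to be the number
  of variables in \<open>J\<close> and choose any \<open>t + 1\<close> of its clauses. A single
  clause already has \<open>k\<close> variables, whence \<open>k \<le> t\<close>.\<close>

lemma satisfiable_if_no_dense_subset:
  assumes "k \<ge> 1" and S: "S \<subseteq> kclauses k n"
    and none: "\<And>t F. k \<le> t \<Longrightarrow> t \<le> n \<Longrightarrow> F \<in> dense_sets k n t \<Longrightarrow> \<not> F \<subseteq> S"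
  shows "satisfiable S"
proof (rule satisfiable_if_hall)
  show "finite S"
    using S finite_clauses_over[of "{1..n}" k] by (auto simp: kclauses_eq intro: finite_subset)
  show "finite c" if "c \<in> S" for c
  proof (rule card_ge_0_finite)
    show "0 < card c" using that S assms(1) by (auto simp: kclauses_def)
  qed
  fix J assume J: "J \<subseteq> S"
  let ?T = "\<Union>c\<in>J. var ` c"
  show "card J \<le> card ?T"
  proof (rule ccontr)
    assume "\<not> card J \<le> card ?T"
    then obtain F where F: "F \<subseteq> J" "card F = card ?T + 1"
      using obtain_subset_with_card_n[of "card ?T + 1" J] by (auto simp: not_le Suc_le_eq)
    have clause: "card c = k" "inj_on var c" "var ` c \<subseteq> {1..n}" if "c \<in> J" for c
      using that J S by (auto simp: kclauses_def)
    have T: "?T \<subseteq> {1..n}" using clause(3) by (rule UN_least)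
    then have finT: "finite ?T" by (rule finite_subset) simp
    have "card ?T \<le> n" using card_mono[OF _ T] by simp
    have "F \<noteq> {}" using F(2) by auto
    then obtain c where c: "c \<in> J" using F(1) by auto
    then have "k = card (var ` c)" using clause[OF c] by (simp add: card_image)
    also have "\<dots> \<le> card ?T" using c finT by (intro card_mono) auto
    finally have "k \<le> card ?T" .
    moreover have "F \<in> dense_sets k n (card ?T)"
      unfolding dense_sets_def
    proof (intro UN_I CollectI conjI)
      show "?T \<subseteq> {1..n}" by (rule T)
      show "F \<subseteq> clauses_over k ?T"
        using F(1) clause by (auto simp: clauses_over_def)
    qed (use F in auto)
    ultimately have "\<not> F \<subseteq> S" using none \<open>card ?T \<le> n\<close> by blast
    then show False using F(1) J by blast
  qed
qed

section \<open>Counting dense sets\<close>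

lemma finite_dense_sets: "finite (dense_sets k n t)"
  unfolding dense_sets_def
proof (intro finite_UN_I)
  fix T assume "T \<in> {T. T \<subseteq> {1..n} \<and> card T = t}"
  then have "finite T" by (auto intro: finite_subset)
  then show "finite {S. S \<subseteq> clauses_over k T \<and> card S = t + 1}"
    using finite_clauses_over by simp
qed simp

lemma card_dense_sets_le:
  "card (dense_sets k n t) \<le> (n choose t) * ((2 ^ k * (t choose k)) choose (t + 1))"
proof -
  let ?\<T> = "{T. T \<subseteq> {1..n} \<and> card T = t}"
  have "card (dense_sets k n t) \<le> (\<Sum>T\<in>?\<T>. card {S. S \<subseteq> clauses_over k T \<and> card S = t + 1})"
    unfolding dense_sets_def by (rule card_UN_le) simp
  also have "\<dots> \<le> (\<Sum>T\<in>?\<T>. (2 ^ k * (t choose k)) choose (t + 1))"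
  proof (rule sum_mono)
    fix T assume T: "T \<in> ?\<T>"
    then have "finite T" by (auto intro: finite_subset)
    then have "card {S. S \<subseteq> clauses_over k T \<and> card S = t + 1} = card (clauses_over k T) choose (t + 1)"
      using finite_clauses_over by (intro n_subsets)
    also have "\<dots> \<le> (2 ^ k * (t choose k)) choose (t + 1)"
      using card_clauses_over_le[OF \<open>finite T\<close>, of k] T by (intro binomial_right_mono) auto
    finally show "card {S. S \<subseteq> clauses_over k T \<and> card S = t + 1} \<le> (2 ^ k * (t choose k)) choose (t + 1)" .
  qed
  also have "\<dots> = (n choose t) * ((2 ^ k * (t choose k)) choose (t + 1))"
    by (simp add: n_subsets)
  finally show ?thesis .
qed

text \<open>The ratio of the two binomials is at most (t/n)^2. Absorbing two factors reduces this to
  monotonicity of the binomial in its upper index and (t-1)/t <= (n-1)/n. The quadratic decay is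
  what later offsets the number of choices of \<open>t\<close> variables.\<close>

lemma binomial_times_square_le:
  assumes "2 \<le> k" "t \<le> n"
  shows "(t choose k) * n\<^sup>2 \<le> (n choose k) * t\<^sup>2"
proof (cases "t < k")
  case False
  have absorb: "k * (k - 1) * (m choose k) = m * (m - 1) * ((m - 2) choose (k - 2))" for m
  proof -
    have "k * (m choose k) = m * ((m - 1) choose (k - 1))"
      using assms(1) by (intro times_binomial_minus1_eq) simp
    moreover have "(k - 1) * ((m - 1) choose (k - 1)) = (m - 1) * ((m - 2) choose (k - 2))"
      using assms(1) times_binomial_minus1_eq[of "k - 1" "m - 1"] by (simp add: numeral_2_eq_2)
    ultimately show ?thesis by (metis mult.assoc mult.commute)
  qed
  have "t - 2 \<le> n - 2" using assms(2) by simp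
  moreover have "(t - 1) * n \<le> t * (n - 1)"
    using assms(2) by (cases t; cases n) (auto simp: algebra_simps)
  ultimately have "(t * n) * (((t - 1) * n) * ((t - 2) choose (k - 2)))
      \<le> (t * n) * ((t * (n - 1)) * ((n - 2) choose (k - 2)))"
    by (intro mult_le_mono2[of _ _ "t * n"] mult_le_mono[of "(t - 1) * n"] binomial_right_mono)
  then have "(k * (k - 1) * (t choose k)) * n\<^sup>2 \<le> (k * (k - 1) * (n choose k)) * t\<^sup>2"
    unfolding absorb by (simp add: power2_eq_square algebra_simps)
  then have "(k * (k - 1)) * ((t choose k) * n\<^sup>2) \<le> (k * (k - 1)) * ((n choose k) * t\<^sup>2)"
    by (simp only: mult.assoc)
  moreover have "0 < k * (k - 1)" using assms(1) by simp
  ultimately show ?thesis by (simp only: mult_le_cancel1)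
qed (simp add: binomial_eq_0)

text \<open>From \<open>m ^ s / fact s\<close> and the bound
  \<open>u ^ s / fact s \<le> exp u\<close>, a single term of the exponential series. Allowing u
  below \<open>s\<close> gives the binomials with lower indices \<open>t\<close> and
  \<open>t + 1\<close> the common denominator \<open>t\<close>.\<close>

lemma binomial_le_exp_power:
  assumes "0 < s" "0 < u" "u \<le> real s"
  shows "real (m choose s) \<le> (exp 1 * real m / u) ^ s"
proof -
  have "u ^ s / fact s \<le> exp 1 ^ s"
  proof -
    have "(\<Sum>i\<in>{s}. u ^ i /\<^sub>R fact i) \<le> (\<Sum>i. u ^ i /\<^sub>R fact i)"
      using assms by (intro sum_le_suminf summable_exp_generic) auto
    then have "u ^ s / fact s \<le> exp u"
      by (simp add: exp_def divide_inverse mult.commute)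
    also have "\<dots> \<le> exp (real s)" using assms by simp
    finally show ?thesis by (simp flip: exp_of_nat_mult)
  qed
  then have "u ^ s \<le> exp 1 ^ s * fact s" by (simp add: field_simps)
  then have "real (m choose s) * u ^ s \<le> real (m choose s) * (exp 1 ^ s * fact s)"
    by (intro mult_left_mono) auto
  also have "\<dots> = exp 1 ^ s * (real (m choose s) * fact s)" by simp
  also have "\<dots> \<le> exp 1 ^ s * real m ^ s"
  proof (rule mult_left_mono)
    show "real (m choose s) * fact s \<le> real m ^ s"
      using binomial_fact_pow[of m s] by (metis of_nat_fact of_nat_le_iff of_nat_mult of_nat_power)
  qed simp
  finally show ?thesis
    using assms by (simp add: power_divide power_mult_distrib pos_le_divide_eq)
qed


lemma dense_sets_weight_le:
  fixes p :: real
  assumes "2 \<le> k" "1 \<le> t" "t \<le> n" "0 \<le> p"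
    and p: "p * (4 * (exp 1)\<^sup>2 * 2 ^ k * real (n choose k)) \<le> real n"
  shows "real (card (dense_sets k n t)) * p ^ (t + 1) \<le> (1/4) ^ (t + 1)"
proof -
  let ?N = "2 ^ k * (t choose k)"
  define u where "u = exp 1 * real n / real t"
  have t: "0 < real t" "0 < real n" using assms(2,3) by auto
  have "exp 1 \<ge> (1::real)" by simp
  then have "exp 1 * real n \<ge> 1 * real t" using assms(3) by (intro mult_mono) auto
  then have u: "1 \<le> u" using t by (simp add: u_def)
  have choose_sq: "real (t choose k) * (real n)\<^sup>2 \<le> real (n choose k) * (real t)\<^sup>2"
    using binomial_times_square_le[OF assms(1,3)] by (metis of_nat_le_iff of_nat_mult of_nat_power)
  have "(p * (4 * (exp 1)\<^sup>2 * 2 ^ k)) * (real (t choose k) * (real n)\<^sup>2)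
      \<le> (p * (4 * (exp 1)\<^sup>2 * 2 ^ k)) * (real (n choose k) * (real t)\<^sup>2)"
    using choose_sq \<open>0 \<le> p\<close> by (intro mult_left_mono) auto
  also have "\<dots> \<le> real n * (real t)\<^sup>2"
    using mult_right_mono[OF p, of "(real t)\<^sup>2"] by (simp add: mult.assoc)
  finally have "4 * (exp 1)\<^sup>2 * real ?N * p * real n \<le> (real t)\<^sup>2"
    using t by (simp add: power2_eq_square mult.assoc mult.left_commute mult.commute)
  \<comment> \<open>With \<open>u = exp 1 * n / t\<close>, the choice of variables costs at most
    \<open>u ^ t\<close>; this bound lets each of the \<open>t + 1\<close> clauses pay back a factor
    \<open>u\<close> and leave 1/4.\<close>
  then have factor: "exp 1 * real ?N / real t * p \<le> 1 / (4 * u)"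
    unfolding u_def using t by (simp add: field_simps power2_eq_square)
  have "real (card (dense_sets k n t)) \<le> real (n choose t) * real (?N choose (t + 1))"
    using card_dense_sets_le[of k n t] by (metis of_nat_le_iff of_nat_mult)
  also have "\<dots> \<le> u ^ t * (exp 1 * real ?N / real t) ^ (t + 1)"
    unfolding u_def using t by (intro mult_mono binomial_le_exp_power) auto
  finally have "real (card (dense_sets k n t)) * p ^ (t + 1)
      \<le> u ^ t * (exp 1 * real ?N / real t) ^ (t + 1) * p ^ (t + 1)"
    using \<open>0 \<le> p\<close> by (intro mult_right_mono) auto
  also have "\<dots> = u ^ t * (exp 1 * real ?N / real t * p) ^ (t + 1)"
    by (simp only: power_mult_distrib mult.assoc)
  also have "\<dots> \<le> u ^ t * (1 / (4 * u)) ^ (t + 1)"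
    using factor t \<open>0 \<le> p\<close> u by (intro mult_left_mono power_mono) auto
  also have "\<dots> = (1/4) ^ (t + 1) / u"
    using u by (simp add: power_mult_distrib power_divide field_simps)
  also have "\<dots> \<le> (1/4) ^ (t + 1)"
    using u by (simp add: divide_le_eq)
  finally show ?thesis .
qed

lemma sum_quarter_powers_less:
  assumes "1 \<le> k"
  shows "(\<Sum>t=k..n. (1/4 :: real) ^ (t + 1)) < 1"
proof -
  have "(\<Sum>t=k..n. (1/4 :: real) ^ (t + 1)) \<le> (\<Sum>t<Suc n. (1/4) ^ (t + 1))"
    by (rule sum_mono2) auto
  also have "\<dots> = (1/4) * (\<Sum>t<Suc n. (1/4) ^ t)"
    unfolding sum_distrib_left by simp
  also have "\<dots> = (1 - (1/4) ^ Suc n) / 3"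
    by (subst sum_gp_strict) simp
  also have "\<dots> \<le> 1 / 3" by (intro divide_right_mono) auto
  finally show ?thesis by simp
qed

text \<open>Under random play the expected number of dense sets claimed is bounded by a geometric
  series of ratio 1/4, so \<open>client_avoids\<close> applies to all dense sets at once.\<close>

theorem client_ksat:
  assumes "2 \<le> k" "1 \<le> n"
    and q: "real q \<ge> 4 * (exp 1)\<^sup>2 * 2 ^ k * real (n choose k) / real n"
  shows "\<exists>\<tau>. client_strategy (kclauses k n) q \<tau> \<and>
    (\<forall>h. legal_play (kclauses k n) q h \<and> client_follows \<tau> h \<longrightarrow> satisfiable (client_claimed h))"
proof -
  let ?X = "kclauses k n" and ?\<F> = "\<Union>t\<in>{k..n}. dense_sets k n t" and ?p = "1 / (real q + 1)"
  have p: "?p * (4 * (exp 1)\<^sup>2 * 2 ^ k * real (n choose k)) \<le> real n"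
  proof -
    have "4 * (exp 1)\<^sup>2 * 2 ^ k * real (n choose k) \<le> real n * real q"
      using q assms(2) by (simp add: field_simps)
    also have "\<dots> \<le> real n * (real q + 1)" by (intro mult_left_mono) auto
    finally show ?thesis by (simp add: field_simps)
  qed
  have card_dense: "card F = t + 1" if "F \<in> dense_sets k n t" for F t
    using that by (auto simp: dense_sets_def)
  have "(\<Sum>F\<in>?\<F>. ?p ^ card F) = (\<Sum>t=k..n. \<Sum>F\<in>dense_sets k n t. ?p ^ card F)"
  proof (rule sum.UNION_disjoint)
    show "\<forall>t\<in>{k..n}. \<forall>u\<in>{k..n}. t \<noteq> u \<longrightarrow> dense_sets k n t \<inter> dense_sets k n u = {}"
      using card_dense by (metis add_right_cancel disjoint_iff)
  qed (simp_all add: finite_dense_sets)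
  also have "\<dots> = (\<Sum>t=k..n. real (card (dense_sets k n t)) * ?p ^ (t + 1))"
    by (intro sum.cong) (simp_all add: card_dense)
  also have "\<dots> \<le> (\<Sum>t=k..n. (1/4) ^ (t + 1))"
    using assms p by (intro sum_mono dense_sets_weight_le) auto
  also have "\<dots> < 1" using assms by (intro sum_quarter_powers_less) simp
  finally have small: "(\<Sum>F\<in>?\<F>. ?p ^ card F) < 1" .
  have fin: "finite ?X" using finite_clauses_over[of "{1..n}" k] by (simp add: kclauses_eq)
  have "F \<subseteq> ?X" if "F \<in> ?\<F>" for F
    using that by (force simp: dense_sets_def clauses_over_def kclauses_def)
  then have "\<exists>\<tau>. client_strategy ?X q \<tau> \<and> (\<forall>h. legal_play ?X q h \<and> client_follows \<tau> h \<longrightarrow>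
      (\<forall>F\<in>?\<F>. \<not> F \<subseteq> client_claimed h))"
    using fin small finite_dense_sets by (intro client_avoids) auto
  then obtain \<tau> where \<tau>: "client_strategy ?X q \<tau>"
    and avoid: "\<forall>h. legal_play ?X q h \<and> client_follows \<tau> h \<longrightarrow> (\<forall>F\<in>?\<F>. \<not> F \<subseteq> client_claimed h)"
    by (elim exE conjE)
  have "satisfiable (client_claimed h)" if "legal_play ?X q h" "client_follows \<tau> h" for h
  proof (rule satisfiable_if_no_dense_subset)
    show "1 \<le> k" using assms(1) by simp
    show "client_claimed h \<subseteq> ?X" using that(1) by (rule client_claimed_subset)
    show "\<not> F \<subseteq> client_claimed h" if "k \<le> t" "t \<le> n" "F \<in> dense_sets k n t" for t F
      using avoid \<open>legal_play ?X q h\<close> \<open>client_follows \<tau> h\<close> that by auto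
  qed
  then show ?thesis using \<tau> by blast
qed

lemma ksat_constant_ge:
  assumes "2 \<le> k"
  shows "4 * (exp 1)\<^sup>2 * 2 ^ k \<le> 2 powr (3 * real k / 2) * exp (real k / 2 + 1) * real k"
proof -
  have "2 ^ k * 2 = (2 :: real) powr (real k + 1)"
    by (simp add: powr_add powr_realpow)
  also have "\<dots> \<le> 2 powr (3 * real k / 2)"
    using assms by (intro powr_mono) auto
  finally have a: "2 ^ k * 2 \<le> (2 :: real) powr (3 * real k / 2)" .
  have "(exp 1)\<^sup>2 = exp (2 :: real)" by (simp flip: exp_of_nat_mult)
  also have "\<dots> \<le> exp (real k / 2 + 1)" using assms by simp
  finally have b: "(exp 1)\<^sup>2 \<le> exp (real k / 2 + 1)" .
  \<comment> \<open>The factor 4 is split into two factors 2, one absorbed by the power of 2 and one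
    by \<open>k\<close>. All three comparisons are equalities at k = 2.\<close>
  have "(2 ^ k * 2) * (exp 1)\<^sup>2 * 2 \<le> 2 powr (3 * real k / 2) * exp (real k / 2 + 1) * real k"
    using assms by (intro mult_mono a b) auto
  then show ?thesis by (simp add: mult.commute mult.left_commute)
qed

text \<open>The threshold 7, the same for all \<open>k\<close>, comes from Waiter's side; on
  Client's side the stated constant dominates the one in \<open>client_ksat\<close>.\<close>

theorem theorem1p4:
  fixes k :: nat
  assumes "k \<ge> 2"
  shows "\<exists>n0::nat. \<forall>n\<ge>n0. \<forall>q::nat. q \<ge> 1 \<longrightarrow>
    (real q \<le> real (n choose k) / (2 * real n) \<longrightarrow>
       (\<exists>\<sigma>. waiter_strategy (kclauses k n) q \<sigma> \<and>
          (\<forall>h. complete_play (kclauses k n) q h \<and> waiter_follows \<sigma> h \<longrightarrow>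
             \<not> satisfiable (client_claimed h)))) \<and>
    (real q \<ge> 2 powr (3 * real k / 2) * exp (real k / 2 + 1) * real k * real (n choose k) / real n \<longrightarrow>
       (\<exists>\<tau>. client_strategy (kclauses k n) q \<tau> \<and>
          (\<forall>h. legal_play (kclauses k n) q h \<and> client_follows \<tau> h \<longrightarrow>
             satisfiable (client_claimed h))))"
proof (intro exI[of _ 7] allI impI conjI, goal_cases)
  case (1 n q)
  then show ?case by (intro waiter_ksat) auto
next
  case (2 n q)
  have "4 * (exp 1)\<^sup>2 * 2 ^ k * real (n choose k) / real n
      \<le> 2 powr (3 * real k / 2) * exp (real k / 2 + 1) * real k * real (n choose k) / real n"
    using ksat_constant_ge[OF assms] by (intro divide_right_mono mult_right_mono) auto
  then show ?case using 2 assms by (intro client_ksat) auto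
qed

end
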